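(* Let $S=\{i_1<\cdots<i_s\}$ be an admissible set. Suppose $p(n)$ and $p_B(n)$ are polynomials such that $\#P(S,n)=p(n)2^{n-s-1}$ and $\#P_B(S,n)=p_B(n)2^{2n-s-1}$ for every $n$ for which $S$ is $n$-admissible. Then $p(n)=p_B(n)$; that is, the same polynomial in $n$ (depending on $S$) works for both the symmetric group $S_n$ and the hyperoctahedral group $B_n$.
   Context: $S_n$ is the symmetric group of permutations $\pi=\pi_1\cdots\pi_n$ of $\{1,\dots,n\}$. For $n\ge1$, $B_n$ is the set of signed permutations $\pi=\pi_1\cdots\pi_n$: words with each $\pi_i\in\{-n,\dots,-1,1,\dots,n\}$ and $\{|\pi_1|,\dots,|\pi_n|\}=\{1,\dots,n\}$. For a (signed) permutation, an index $i\in\{2,\dots,n-1\}$ is a peak if $\pi_{i-1}<\pi_i>\pi_{i+1}$. $P(S,n)$ is the set of $\pi\in S_n$ whose peak set equals $S$, and $P_B(S,n)$ the set of $\pi\in B_n$ whose peak set equals $S$. $S$ is $n$-admissible if $\#P_B(S,n)\ne0$ (equivalently $\#P(S,n)\neq 0$: $S\subseteq\{2,\dots,n-1\}$ contains no two consecutive integers); $S$ is admissible if it is $n$-admissible for some $n$. (By Billey–Burdzy–Sagan such a polynomial $p$ exists for $S_n$.) *)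

theory Defs
  imports "HOL-Library.FuncSet" "HOL-Combinatorics.Permutations"
    "HOL-Computational_Algebra.Polynomial"
begin

text \<open>A word \<open>w\<^sub>1 \<dots> w\<^sub>n\<close> is encoded as the function \<open>i \<mapsto> w\<^sub>i\<close> on \<open>{1..n}\<close>, whatever its values elsewhere;
  for \<open>n \<le> 2\<close> the interval \<open>{2..n - 1}\<close> is empty, also under truncated subtraction.\<close>

definition peak_set :: "nat \<Rightarrow> (nat \<Rightarrow> 'a::linorder) \<Rightarrow> nat set" where
  "peak_set n w = {i \<in> {2..n - 1}. w (i - 1) < w i \<and> w i > w (i + 1)}"

text \<open>Outside \<open>{1..n}\<close> a signed permutation is \<open>undefined\<close> (by \<open>\<rightarrow>\<^sub>E\<close>) and an element of \<open>S\<^sub>n\<close> is the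
  identity (by \<open>permutes\<close>), so that functions correspond one-to-one to words and cardinalities
  are the intended ones.\<close>

definition signed_perms :: "nat \<Rightarrow> (nat \<Rightarrow> int) set" where
  "signed_perms n =
     {w \<in> {1..n} \<rightarrow>\<^sub>E ({- int n..- 1} \<union> {1..int n}). (\<lambda>i. \<bar>w i\<bar>) ` {1..n} = {1..int n}}"

definition peak_perms :: "nat set \<Rightarrow> nat \<Rightarrow> (nat \<Rightarrow> nat) set" where
  "peak_perms S n = {w. w permutes {1..n} \<and> peak_set n w = S}"

definition peak_signed_perms :: "nat set \<Rightarrow> nat \<Rightarrow> (nat \<Rightarrow> int) set" where
  "peak_signed_perms S n = {w \<in> signed_perms n. peak_set n w = S}"

text \<open>The groups are only considered for \<open>n \<ge> 1\<close>. This matters for \<open>S = {}\<close>: counting the empty word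
  would make \<open>{}\<close> 0-admissible, and the formula \<open>p(n) 2\<^sup>n\<^sup>-\<^sup>s\<^sup>-\<^sup>1\<close> with \<open>p = 1\<close> fails at \<open>n = 0\<close>.\<close>

definition n_admissible :: "nat \<Rightarrow> nat set \<Rightarrow> bool" where
  "n_admissible n S \<longleftrightarrow> n \<ge> 1 \<and> card (peak_signed_perms S n) \<noteq> 0"

definition admissible :: "nat set \<Rightarrow> bool" where
  "admissible S \<longleftrightarrow> (\<exists>n. n_admissible n S)"

end

theory Submission
  imports Defs
begin

text \<open>A signed permutation is determined by the set of letters that carry a minus sign and by the
  relative order of its entries. The peak set depends only on the relative order, so each of the
  \<open>2\<^sup>n\<close> sign choices contributes \<open>#P(S,n)\<close> words to \<open>P\<^sub>B(S,n)\<close>, and \<open>#P\<^sub>B(S,n) = 2\<^sup>n #P(S,n)\<close>.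
  Hence the two polynomials agree at every \<open>n\<close> for which \<open>S\<close> is admissible. There are infinitely many
  of these, because appending the letter \<open>n + 1\<close> to a permutation does not change its peak set.\<close>

section \<open>Order-preserving relabelling of words\<close>

text \<open>Peaks depend only on comparisons, which a strictly monotone \<open>e\<close> preserves
  and reflects. Restricting is harmless: for \<open>i\<close> in \<open>{2..n - 1}\<close> both
  neighbours of \<open>i\<close> lie in \<open>{1..n}\<close>.\<close>

lemma peak_set_strict_mono_comp:
  assumes "strict_mono_on {1..n} e" and "w \<in> {1..n} \<rightarrow> {1..n}"
  shows "peak_set n (restrict (e \<circ> w) {1..n}) = peak_set n w"
proof -
  have less: "e (w i) < e (w j) \<longleftrightarrow> w i < w j" if "i \<in> {1..n}" "j \<in> {1..n}" for i j
    using assms that by (intro strict_mono_on_less) auto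
  show ?thesis
    unfolding peak_set_def by (intro Collect_cong) (auto simp: less)
qed

lemma ex_strict_mono_bij_betw:
  fixes V :: "'a::linorder set"
  assumes "finite V"
  shows "\<exists>e. bij_betw e {1..card V} V \<and> strict_mono_on {1..card V} e"
proof -
  let ?xs = "sorted_list_of_set V"
  \<comment> \<open>The increasing enumeration of \<open>V\<close>; the shift reconciles positions
    starting at 1 with list indices starting at 0.\<close>
  define e where "e i = ?xs ! (i - 1)" for i
  have mono: "strict_mono_on {1..card V} e"
  proof (rule strict_mono_onI)
    fix i j assume "i \<in> {1..card V}" "j \<in> {1..card V}" "i < j"
    then show "e i < e j"
      using sorted_wrt_nth_less[OF strict_sorted_list_of_set, of "i - 1" "j - 1" V]
      by (auto simp: e_def)
  qed
  have "e ` {1..card V} = V"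
  proof -
    have nth: "(!) ys ` {..<length ys} = set ys" for ys :: "'a list"
      by (auto simp: set_conv_nth)
    have "{1..card V} = Suc ` {..<card V}"
      by (simp add: image_Suc_lessThan)
    then have "e ` {1..card V} = (!) ?xs ` {..<length ?xs}"
      by (simp add: e_def image_image)
    also have "\<dots> = V"
      using assms by (simp only: nth set_sorted_list_of_set)
    finally show ?thesis .
  qed
  with mono show ?thesis
    by (auto simp: bij_betw_def intro: strict_mono_on_imp_inj_on)
qed

section \<open>Signed permutations classified by their sets of letters\<close>

text \<open>A choice of signs is encoded as the set \<open>A\<close> of absolute values that receive
  a minus sign.\<close>

definition signed_letter :: "nat set \<Rightarrow> nat \<Rightarrow> int" where
  "signed_letter A i = (if i \<in> A then - int i else int i)"

lemma inj_on_signed_letter: "inj_on (signed_letter A) {1..n}"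
  by (auto simp: inj_on_def signed_letter_def split: if_splits)

text \<open>The choice of signs can be read off from the letters, since \<open>- a\<close> occurs
  exactly when \<open>a\<close> is in the chosen set. This makes the classes counted later
  disjoint.\<close>

lemma signed_letter_image_inject:
  assumes "A \<subseteq> {1..n}" "B \<subseteq> {1..n}"
    and "signed_letter A ` {1..n} = signed_letter B ` {1..n}"
  shows "A = B"
proof -
  have neg: "- int a \<in> signed_letter C ` {1..n} \<longleftrightarrow> a \<in> C" if "C \<subseteq> {1..n}" "a \<in> {1..n}" for a C
    using that by (force simp: signed_letter_def image_iff split: if_splits)
  have "a \<in> A \<longleftrightarrow> a \<in> B" if "a \<in> {1..n}" for a
    using neg[OF assms(1) that] neg[OF assms(2) that] unfolding assms(3) by simp
  with assms(1,2) show ?thesis by blast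
qed

lemma signed_perms_iff:
  "w \<in> signed_perms n \<longleftrightarrow>
    w \<in> extensional {1..n} \<and> (\<exists>A\<subseteq>{1..n}. bij_betw w {1..n} (signed_letter A ` {1..n}))"
    (is "?L \<longleftrightarrow> ?R")
proof
  assume w: ?L
  then have w_ext: "w \<in> extensional {1..n}"
    and abs_w: "(\<lambda>i. \<bar>w i\<bar>) ` {1..n} = {1..int n}"
    by (auto simp: signed_perms_def PiE_def)
  \<comment> \<open>The absolute values map a set of \<open>n\<close> positions onto a set of
    \<open>n\<close> numbers, hence injectively.\<close>
  have inj_abs: "inj_on (\<lambda>i. \<bar>w i\<bar>) {1..n}"
    by (rule eq_card_imp_inj_on, simp, simp only: abs_w) simp
  then have inj_w: "inj_on w {1..n}"
    using inj_on_imageI2[of abs w] by (simp only: o_def)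
  define A where "A = {a \<in> {1..n}. - int a \<in> w ` {1..n}}"
  have "w ` {1..n} \<subseteq> signed_letter A ` {1..n}"
  proof
    fix v assume v: "v \<in> w ` {1..n}"
    with abs_w have "\<bar>v\<bar> \<in> {1..int n}" by blast
    then have a: "nat \<bar>v\<bar> \<in> {1..n}" by auto
    have "signed_letter A (nat \<bar>v\<bar>) = v"
    proof (cases "v < 0")
      case True
      with v a have "nat \<bar>v\<bar> \<in> A" by (simp add: A_def)
      with True show ?thesis by (simp add: signed_letter_def)
    next
      case False
      \<comment> \<open>Otherwise both \<open>v\<close> and \<open>- v\<close> occur; having the
        same absolute value they share a position, so \<open>v = 0\<close>, which is no
        letter.\<close>
      have "nat \<bar>v\<bar> \<notin> A"
      proof
        assume "nat \<bar>v\<bar> \<in> A"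
        with False obtain j where j: "j \<in> {1..n}" "w j = - v"
          by (auto simp: A_def)
        from v obtain i where i: "i \<in> {1..n}" "w i = v" by auto
        have "i = j"
          by (rule inj_onD[OF inj_abs _ i(1) j(1)]) (simp add: i j)
        with i j a show False by simp
      qed
      with False show ?thesis by (simp add: signed_letter_def)
    qed
    with a show "v \<in> signed_letter A ` {1..n}" by (metis imageI)
  qed
  moreover have "card (w ` {1..n}) = card (signed_letter A ` {1..n})"
    by (simp only: card_image[OF inj_w] card_image[OF inj_on_signed_letter])
  ultimately have "w ` {1..n} = signed_letter A ` {1..n}"
    by (intro card_subset_eq) auto
  with inj_w have "bij_betw w {1..n} (signed_letter A ` {1..n})"
    by (simp add: bij_betw_def)
  moreover have "A \<subseteq> {1..n}"
    by (auto simp: A_def)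
  ultimately show ?R
    using w_ext by blast
next
  assume ?R
  then obtain A where w_ext: "w \<in> extensional {1..n}"
    and img: "w ` {1..n} = signed_letter A ` {1..n}"
    by (auto simp: bij_betw_def)
  have "(\<lambda>i. \<bar>w i\<bar>) ` {1..n} = (\<lambda>i. \<bar>signed_letter A i\<bar>) ` {1..n}"
    using arg_cong[OF img, of "image abs"] by (simp add: image_image)
  also have "\<dots> = int ` {1..n}"
    by (intro image_cong) (auto simp: signed_letter_def)
  finally have abs_w: "(\<lambda>i. \<bar>w i\<bar>) ` {1..n} = {1..int n}"
    by (simp add: image_int_atLeastAtMost)
  have "w i \<in> {- int n..- 1} \<union> {1..int n}" if "i \<in> {1..n}" for i
  proof -
    from that have "\<bar>w i\<bar> \<in> {1..int n}"
      unfolding abs_w[symmetric] by blast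
    then show ?thesis by auto
  qed
  with w_ext abs_w show ?L
    by (auto simp: signed_perms_def PiE_def)
qed

text \<open>This is standardization: composing with the increasing enumeration \<open>e\<close> of
  the letters turns permutations of \<open>{1..n}\<close> bijectively into words on these letters
  and keeps the peak set.\<close>

lemma card_peak_signed_perms_letters:
  assumes A: "A \<subseteq> {1..n}"
  shows "card {w \<in> peak_signed_perms S n. w ` {1..n} = signed_letter A ` {1..n}} =
    card (peak_perms S n)" (is "card ?F = _")
proof -
  let ?V = "signed_letter A ` {1..n}"
  have "card ?V = n"
    using card_image[OF inj_on_signed_letter[of A n]] by simp
  then obtain e where e: "bij_betw e {1..n} ?V" and mono: "strict_mono_on {1..n} e"
    using ex_strict_mono_bij_betw[of ?V] by auto
  \<comment> \<open>\<open>restrict\<close> supplies the value \<open>undefined\<close> that signed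
    words take outside \<open>{1..n}\<close>, where \<open>\<pi>\<close> is the identity.\<close>
  let ?f = "\<lambda>\<pi>. restrict (e \<circ> \<pi>) {1..n}"
  have "bij_betw ?f (peak_perms S n) ?F"
  proof (rule bij_betw_imageI)
    show "inj_on ?f (peak_perms S n)"
    proof (rule inj_onI)
      fix \<pi> \<rho> assume "\<pi> \<in> peak_perms S n" "\<rho> \<in> peak_perms S n" and eq: "?f \<pi> = ?f \<rho>"
      then have p: "\<pi> permutes {1..n}" "\<rho> permutes {1..n}"
        by (auto simp: peak_perms_def)
      show "\<pi> = \<rho>"
      proof
        fix i
        show "\<pi> i = \<rho> i"
        proof (cases "i \<in> {1..n}")
          case True
          with fun_cong[OF eq, of i] have "e (\<pi> i) = e (\<rho> i)" by simp
          moreover have "\<pi> i \<in> {1..n}" "\<rho> i \<in> {1..n}"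
            using True p by (simp_all only: permutes_in_image)
          ultimately show ?thesis
            using bij_betw_imp_inj_on[OF e] by (auto dest: inj_onD)
        next
          case False
          with p show ?thesis by (simp add: permutes_not_in)
        qed
      qed
    qed
    show "?f ` peak_perms S n = ?F"
    proof (intro equalityI subsetI)
      fix w assume "w \<in> ?f ` peak_perms S n"
      then obtain \<pi> where \<pi>: "\<pi> permutes {1..n}" "peak_set n \<pi> = S" and w: "w = ?f \<pi>"
        by (auto simp: peak_perms_def)
      have "bij_betw (e \<circ> \<pi>) {1..n} ?V"
        using permutes_imp_bij[OF \<pi>(1)] e by (rule bij_betw_trans)
      then have bij: "bij_betw w {1..n} ?V"
        unfolding w by (simp only: bij_betw_restrict_eq)
      then have "w \<in> signed_perms n"
        using A by (auto simp: signed_perms_iff w)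
      moreover have "peak_set n w = S"
        unfolding w using mono \<pi>(2) permutes_in_image[OF \<pi>(1)]
        by (subst peak_set_strict_mono_comp) auto
      ultimately show "w \<in> ?F"
        using bij by (auto simp: peak_signed_perms_def bij_betw_def)
    next
      fix w assume "w \<in> ?F"
      then have w: "w \<in> extensional {1..n}" "bij_betw w {1..n} ?V" "peak_set n w = S"
        by (auto simp: peak_signed_perms_def signed_perms_iff bij_betw_def)
      \<comment> \<open>The preimage of \<open>w\<close> replaces each entry by its rank among the
        letters and is the identity elsewhere, as \<open>permutes\<close> demands.\<close>
      define \<pi> where "\<pi> i = (if i \<in> {1..n} then inv_into {1..n} e (w i) else i)" for i
      have "bij_betw (inv_into {1..n} e \<circ> w) {1..n} {1..n}"
        using w(2) bij_betw_inv_into[OF e] by (rule bij_betw_trans)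
      then have "bij_betw \<pi> {1..n} {1..n}"
        by (rule bij_betw_cong[THEN iffD1, rotated]) (simp add: \<pi>_def)
      then have perm: "\<pi> permutes {1..n}"
        by (rule bij_imp_permutes) (simp only: \<pi>_def if_False)
      have f: "?f \<pi> = w"
      proof (rule extensionalityI)
        fix i assume i: "i \<in> {1..n}"
        then have "w i \<in> e ` {1..n}"
          using w(2) e by (auto simp: bij_betw_def)
        with i show "?f \<pi> i = w i"
          by (simp add: \<pi>_def f_inv_into_f)
      qed (use w(1) in auto)
      have "peak_set n \<pi> = S"
        using w(3) peak_set_strict_mono_comp
            [OF mono bij_betw_imp_funcset[OF permutes_imp_bij[OF perm]]]
        by (simp only: f)
      with perm f show "w \<in> ?f ` peak_perms S n"
        by (auto simp: peak_perms_def)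
    qed
  qed
  then show ?thesis
    by (simp add: bij_betw_same_card)
qed

lemma finite_signed_perms: "finite (signed_perms n)"
proof (rule finite_subset)
  show "signed_perms n \<subseteq> {1..n} \<rightarrow>\<^sub>E ({- int n..- 1} \<union> {1..int n})"
    by (auto simp: signed_perms_def)
qed (intro finite_PiE; simp)

lemma card_peak_signed_perms:
  "card (peak_signed_perms S n) = 2 ^ n * card (peak_perms S n)"
proof -
  let ?F = "\<lambda>A. {w \<in> peak_signed_perms S n. w ` {1..n} = signed_letter A ` {1..n}}"
  have fin: "finite (?F A)" for A
    by (rule finite_subset[OF _ finite_signed_perms[of n]]) (auto simp: peak_signed_perms_def)
  have "peak_signed_perms S n = (\<Union>A\<in>Pow {1..n}. ?F A)"
    by (auto simp: peak_signed_perms_def signed_perms_iff bij_betw_def)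
  then have "card (peak_signed_perms S n) = card (\<Union>A\<in>Pow {1..n}. ?F A)"
    by simp
  also have "\<dots> = (\<Sum>A\<in>Pow {1..n}. card (?F A))"
  proof (rule card_UN_disjoint)
    show "\<forall>A\<in>Pow {1..n}. \<forall>B\<in>Pow {1..n}. A \<noteq> B \<longrightarrow> ?F A \<inter> ?F B = {}"
    proof (intro ballI impI)
      fix A B assume "A \<in> Pow {1..n}" "B \<in> Pow {1..n}" "A \<noteq> B"
      then have "signed_letter A ` {1..n} \<noteq> signed_letter B ` {1..n}"
        by (metis PowD signed_letter_image_inject)
      then show "?F A \<inter> ?F B = {}" by auto
    qed
  qed (use fin in auto)
  also have "\<dots> = (\<Sum>A\<in>Pow {1..n}. card (peak_perms S n))"
    by (rule sum.cong[OF refl]) (simp only: card_peak_signed_perms_letters Pow_iff)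
  also have "\<dots> = 2 ^ n * card (peak_perms S n)"
    by (simp add: card_Pow)
  finally show ?thesis .
qed

section \<open>Admissibility for infinitely many lengths\<close>

text \<open>The factor \<open>2 ^ n\<close> never vanishes, so admissibility can be studied on
  unsigned permutations.\<close>

lemma n_admissible_iff: "n_admissible n S \<longleftrightarrow> n \<ge> 1 \<and> peak_perms S n \<noteq> {}"
proof -
  have "finite (peak_perms S n)"
    by (rule finite_subset[OF _ finite_permutations[of "{1..n}"]]) (auto simp: peak_perms_def)
  then show ?thesis
    by (simp add: n_admissible_def card_peak_signed_perms)
qed

text \<open>As \<open>w\<close> fixes \<open>Suc n\<close>, the same function also encodes the word
  with the letter \<open>Suc n\<close> appended. The only new candidate for a peak is
  \<open>n\<close>, and it is followed by a larger entry.\<close>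

lemma peak_set_Suc:
  assumes w: "w permutes {1..n}" and "n \<ge> 1"
  shows "peak_set (Suc n) w = peak_set n w"
proof -
  have "w n \<le> n"
    using permutes_in_image[OF w, of n] \<open>n \<ge> 1\<close> by simp
  moreover have "w (Suc n) = Suc n"
    using w by (simp add: permutes_not_in)
  ultimately have "\<not> w n > w (Suc n)" by simp
  then have "i \<noteq> n" if "i \<in> peak_set (Suc n) w" for i
    using that by (auto simp: peak_set_def)
  then show ?thesis
    by (fastforce simp: peak_set_def)
qed

lemma n_admissible_Suc:
  assumes "n_admissible n S"
  shows "n_admissible (Suc n) S"
proof -
  from assms obtain w where "n \<ge> 1" "w permutes {1..n}" "peak_set n w = S"
    by (auto simp: n_admissible_iff peak_perms_def)
  then have "w \<in> peak_perms S (Suc n)"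
    by (auto simp: peak_perms_def peak_set_Suc intro: permutes_subset)
  then show ?thesis
    by (auto simp: n_admissible_iff)
qed

lemma infinite_n_admissible:
  assumes "admissible S"
  shows "infinite {n. n_admissible n S}"
proof -
  from assms obtain m where m: "n_admissible m S"
    by (auto simp: admissible_def)
  have "n_admissible n S" if "m \<le> n" for n
    using that m by (induction rule: dec_induct) (auto intro: n_admissible_Suc)
  then have "{m..} \<subseteq> {n. n_admissible n S}" by auto
  then show ?thesis
    using infinite_Ici finite_subset by blast
qed

section \<open>Comparison of the two polynomials\<close>

lemma poly_eqI_infinite:
  fixes p q :: "'a::idom poly"
  assumes "infinite A" and "\<And>x. x \<in> A \<Longrightarrow> poly p x = poly q x"
  shows "p = q"
proof (rule ccontr)
  assume "p \<noteq> q"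
  then have "finite {x. poly (p - q) x = 0}"
    by (intro poly_roots_finite) simp
  moreover have "A \<subseteq> {x. poly (p - q) x = 0}"
    using assms(2) by auto
  ultimately show False
    using assms(1) finite_subset by blast
qed

theorem theorem2p7:
  fixes S :: "nat set" and p p\<^sub>B :: "'a::field_char_0 poly"
  assumes "admissible S"
    and "\<And>n. n_admissible n S \<Longrightarrow>
      of_nat (card (peak_perms S n)) = poly p (of_nat n) * 2 powi (int n - int (card S) - 1)"
    and "\<And>n. n_admissible n S \<Longrightarrow>
      of_nat (card (peak_signed_perms S n)) =
        poly p\<^sub>B (of_nat n) * 2 powi (2 * int n - int (card S) - 1)"
  shows "p = p\<^sub>B"
proof (rule poly_eqI_infinite)
  \<comment> \<open>Characteristic 0 makes \<open>of_nat\<close> injective, so infinitely many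
    lengths give infinitely many evaluation points.\<close>
  show "infinite ((of_nat :: nat \<Rightarrow> 'a) ` {n. n_admissible n S})"
    using infinite_n_admissible[OF assms(1)] by (simp add: finite_image_iff inj_on_def)
next
  fix x :: 'a assume "x \<in> of_nat ` {n. n_admissible n S}"
  then obtain n where x: "x = of_nat n" and n: "n_admissible n S" by auto
  \<comment> \<open>The two exponents of 2 differ by exactly \<open>n\<close>, which matches the
    factor \<open>2 ^ n\<close> between the two counts. The remaining power of 2 is nonzero and
    cancels at the end.\<close>
  let ?k = "int n - int (card S) - 1"
  have "(2::'a) powi (2 * int n - int (card S) - 1) = 2 powi (int n + ?k)"
    by (simp add: algebra_simps)
  also have "\<dots> = 2 ^ n * 2 powi ?k"
    by (subst power_int_add) auto
  finally have pow: "(2::'a) powi (2 * int n - int (card S) - 1) = 2 ^ n * 2 powi ?k" .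
  have "poly p\<^sub>B x * (2 ^ n * 2 powi ?k) = of_nat (card (peak_signed_perms S n))"
    using assms(3)[OF n] by (simp only: x pow)
  also have "\<dots> = 2 ^ n * of_nat (card (peak_perms S n))"
    by (simp add: card_peak_signed_perms)
  also have "\<dots> = poly p x * (2 ^ n * 2 powi ?k)"
    by (simp only: assms(2)[OF n] x mult_ac)
  finally show "poly p x = poly p\<^sub>B x"
    by simp
qed

end
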